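(* Let $A,B\in\mathrm{SL}_2\mathbb{Z}_{\ge0}$ be noncommuting and such that the pair $A,B$ is well oriented, and assume $\mathrm{tr}(A)<\mathrm{tr}(B)$ and $\mathrm{tr}(AB)=\mathrm{tr}(B^2)$. Then $ab^2$ is the only optimal word.
   Context: $\mathrm{SL}_2\mathbb{Z}_{\ge0}$ denotes the $2\times2$ matrices with nonnegative integer entries and determinant $1$. Fixed points are taken for the Möbius action on $\partial\mathcal{H}=\mathbb{P}^1\mathbb{R}$; $\alpha^\pm$ ($\beta^\pm$) are the attracting/repelling fixed points of $A$ ($B$), equal to the unique fixed point if parabolic. With $\partial\mathcal{H}$ cyclically ordered and $[\alpha,\beta]$ the closed counterclockwise interval from $\alpha$ to $\beta$, let $I^+=\{\alpha^+\}$ if $\alpha^+=\beta^+$, and otherwise the one of $[\alpha^+,\beta^+],[\beta^+,\alpha^+]$ mapped into itself by both $A$ and $B$ (if it exists); define $I^-$ likewise with $A^{-1},B^{-1},\alpha^-,\beta^-$. The pair is coherently oriented if both exist, and well oriented if $A,B$ is coherently oriented but $A,B^{-1}$ is not. Words: $F_2^+$ is the free semigroup of nonempty words over $\{a,b\}$, $|w|$ the length, $\phi(a)=A,\phi(b)=B$, $[w]=\mathrm{tr}(\phi(w))$. Define $w\preceq u$ iff $[w^{|u|}]\le[u^{|w|}]$; $w$ is maximal if $u\preceq w$ for all $u$. A Lyndon word is one strictly smaller lexicographically ($a<b$) than each of its proper rotations. A complete set of optimal words is a set of pairwise distinct maximal Lyndon words such that every maximal word is a power of a rotation of one of them; it is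 unique if it exists, and its elements are the optimal words. *)

theory Defs
  imports "HOL-Analysis.Analysis"
begin

type_synonym imat = "int^2^2"

definition SL2_nonneg :: "imat set" where
  "SL2_nonneg = {M. det M = 1 \<and> (\<forall>i j. M $ i $ j \<ge> 0)}"

text \<open>The boundary of the hyperbolic plane, P^1(R) = R \<union> {\<infinity>}.\<close>
datatype pt = Fin real | Infty

definition mob :: "imat \<Rightarrow> pt \<Rightarrow> pt" where
  "mob M p = (let a = real_of_int (M$1$1); b = real_of_int (M$1$2);
                  c = real_of_int (M$2$1); d = real_of_int (M$2$2) in
     (case p of
        Infty \<Rightarrow> (if c = 0 then Infty else Fin (a / c))
      | Fin x \<Rightarrow> (if c * x + d = 0 then Infty else Fin ((a * x + b) / (c * x + d)))))"

definition is_fixed :: "imat \<Rightarrow> pt \<Rightarrow> bool" where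
  "is_fixed M p \<longleftrightarrow> mob M p = p"

text \<open>Eigenvalue of M on the line represented by a point: the vector (x,1) for Fin x,
  the vector (1,0) for Infty (meaningful at fixed points).\<close>
definition eig_at :: "imat \<Rightarrow> pt \<Rightarrow> real" where
  "eig_at M p = (case p of
      Infty \<Rightarrow> real_of_int (M$1$1)
    | Fin x \<Rightarrow> real_of_int (M$2$1) * x + real_of_int (M$2$2))"

definition attr_fix :: "imat \<Rightarrow> pt" where
  "attr_fix M = (if \<exists>!p. is_fixed M p then (THE p. is_fixed M p)
                 else (THE p. is_fixed M p \<and> \<bar>eig_at M p\<bar> > 1))"

definition rep_fix :: "imat \<Rightarrow> pt" where
  "rep_fix M = (if \<exists>!p. is_fixed M p then (THE p. is_fixed M p)
                else (THE p. is_fixed M p \<and> \<bar>eig_at M p\<bar> < 1))"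

definition cyc_interval :: "pt \<Rightarrow> pt \<Rightarrow> pt set" where
  "cyc_interval p q = (case (p, q) of
      (Fin x, Fin y) \<Rightarrow> (if x \<le> y then {Fin z | z. x \<le> z \<and> z \<le> y}
                         else {Fin z | z. x \<le> z \<or> z \<le> y} \<union> {Infty})
    | (Fin x, Infty) \<Rightarrow> {Fin z | z. x \<le> z} \<union> {Infty}
    | (Infty, Fin y) \<Rightarrow> {Fin z | z. z \<le> y} \<union> {Infty}
    | (Infty, Infty) \<Rightarrow> {Infty})"

definition interval_exists :: "(imat \<Rightarrow> pt) \<Rightarrow> imat \<Rightarrow> imat \<Rightarrow> bool" where
  "interval_exists fp A B \<longleftrightarrow>
     fp A = fp B \<or>
     (\<exists>I \<in> {cyc_interval (fp A) (fp B), cyc_interval (fp B) (fp A)}.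
        mob A ` I \<subseteq> I \<and> mob B ` I \<subseteq> I)"

definition coherently_oriented :: "imat \<Rightarrow> imat \<Rightarrow> bool" where
  "coherently_oriented A B \<longleftrightarrow>
     interval_exists attr_fix A B \<and>
     (rep_fix A = rep_fix B \<or>
      (\<exists>I \<in> {cyc_interval (rep_fix A) (rep_fix B), cyc_interval (rep_fix B) (rep_fix A)}.
         mob (matrix_inv A) ` I \<subseteq> I \<and> mob (matrix_inv B) ` I \<subseteq> I))"

definition well_oriented :: "imat \<Rightarrow> imat \<Rightarrow> bool" where
  "well_oriented A B \<longleftrightarrow> coherently_oriented A B \<and> \<not> coherently_oriented A (matrix_inv B)"

text \<open>Words over the alphabet {a, b}; F_2^+ = nonempty lists.\<close>
datatype letter = La | Lb

definition phi :: "imat \<Rightarrow> imat \<Rightarrow> letter list \<Rightarrow> imat" where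
  "phi A B w = foldr (\<lambda>l M. (case l of La \<Rightarrow> A | Lb \<Rightarrow> B) ** M) w (mat 1)"

definition wtr :: "imat \<Rightarrow> imat \<Rightarrow> letter list \<Rightarrow> int" where
  "wtr A B w = trace (phi A B w)"

definition wpow :: "letter list \<Rightarrow> nat \<Rightarrow> letter list" where
  "wpow w n = concat (replicate n w)"

definition wle :: "imat \<Rightarrow> imat \<Rightarrow> letter list \<Rightarrow> letter list \<Rightarrow> bool" where
  "wle A B w u \<longleftrightarrow> wtr A B (wpow w (length u)) \<le> wtr A B (wpow u (length w))"

definition maximal_word :: "imat \<Rightarrow> imat \<Rightarrow> letter list \<Rightarrow> bool" where
  "maximal_word A B w \<longleftrightarrow> w \<noteq> [] \<and> (\<forall>u. u \<noteq> [] \<longrightarrow> wle A B u w)"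

definition lex_less :: "letter list \<Rightarrow> letter list \<Rightarrow> bool" where
  "lex_less u v \<longleftrightarrow> (u, v) \<in> lexord {(La, Lb)}"

definition lyndon :: "letter list \<Rightarrow> bool" where
  "lyndon w \<longleftrightarrow> w \<noteq> [] \<and> (\<forall>k. 0 < k \<and> k < length w \<longrightarrow> lex_less w (rotate k w))"

definition complete_optimal_set :: "imat \<Rightarrow> imat \<Rightarrow> letter list set \<Rightarrow> bool" where
  "complete_optimal_set A B S \<longleftrightarrow>
     (\<forall>w \<in> S. maximal_word A B w \<and> lyndon w) \<and>
     (\<forall>w. maximal_word A B w \<longrightarrow>
        (\<exists>v \<in> S. \<exists>k n. n \<ge> 1 \<and> w = wpow (rotate k v) n))"

end

theory Submission
  imports Defs
begin

text \<open>Write \<open>s = tr A\<close>, \<open>t = tr B\<close>. The traces of all words depend only on \<open>s\<close>, \<open>t\<close> and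
  \<open>tr AB = t\<^sup>2 - 2\<close>, so the pair may be replaced by any real pair with the same three traces. In a
  first model \<open>A\<close> and \<open>B\<close> are nonnegative triangular matrices with \<open>A\<^sup>2B < AB\<^sup>2\<close> entrywise, hence
  replacing \<open>aab\<close> by \<open>abb\<close> increases the trace and one may assume that a word is a product of the
  factors \<open>ab\<close> and \<open>b\<close>. In a second model these factors are nonnegative triangular matrices
  \<open>X\<close>, \<open>Y\<close>, and, \<open>\<tau>\<^sup>3\<close> being the leading eigenvalue of \<open>AB\<^sup>2 = XY\<close>, there are positive row vectors
  \<open>f, g\<close> with \<open>fX = \<tau>\<^sup>2g\<close>, \<open>gY = \<tau>f\<close>, \<open>fY < \<tau>f\<close> and \<open>gX < \<tau>\<^sup>2g\<close>. So among the words of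
  length \<open>3n\<close> the trace is largest exactly on the rotations of \<open>(ab\<^sup>2)\<^sup>n\<close>, where \<open>X\<close> and \<open>Y\<close>
  alternate cyclically.\<close>

subsection \<open>Two-by-two matrices and word products\<close>

definition mat2 :: "real \<Rightarrow> real \<Rightarrow> real \<Rightarrow> real \<Rightarrow> real^2^2" where
  "mat2 a b c d = vector [vector [a, b], vector [c, d]]"

lemma mat2_nth [simp]:
  "mat2 a b c d $ 1 $ 1 = a" "mat2 a b c d $ 1 $ 2 = b"
  "mat2 a b c d $ 2 $ 1 = c" "mat2 a b c d $ 2 $ 2 = d"
  by (simp_all add: mat2_def)

lemma mult2_nth:
  fixes M N :: "'a::semiring_1^2^2"
  shows "(M ** N) $ i $ j = M $ i $ 1 * N $ 1 $ j + M $ i $ 2 * N $ 2 $ j"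
  by (simp add: matrix_matrix_mult_def sum_2)

lemma mat1_nth:
  "(mat 1 :: 'a::semiring_1^2^2) $ 1 $ 1 = 1" "(mat 1 :: 'a^2^2) $ 1 $ 2 = 0"
  "(mat 1 :: 'a^2^2) $ 2 $ 1 = 0" "(mat 1 :: 'a^2^2) $ 2 $ 2 = 1"
  by (simp_all add: mat_def)

lemma trace_2: "trace (M :: 'a::comm_semiring_1^2^2) = M $ 1 $ 1 + M $ 2 $ 2"
  by (simp add: trace_def sum_2)

lemma mat2_eqI:
  fixes M N :: "'a^2^2"
  assumes "M $ 1 $ 1 = N $ 1 $ 1" "M $ 1 $ 2 = N $ 1 $ 2"
    "M $ 2 $ 1 = N $ 2 $ 1" "M $ 2 $ 2 = N $ 2 $ 2"
  shows "M = N"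
  using assms by (simp add: vec_eq_iff forall_2)

text \<open>Evaluation is over the reals because the model pairs that replace the given one have
  irrational entries in general.\<close>

fun wprod :: "real^2^2 \<Rightarrow> real^2^2 \<Rightarrow> letter list \<Rightarrow> real^2^2" where
  "wprod A B [] = mat 1"
| "wprod A B (La # w) = A ** wprod A B w"
| "wprod A B (Lb # w) = B ** wprod A B w"

lemma wprod_append: "wprod A B (u @ v) = wprod A B u ** wprod A B v"
  by (induction A B u rule: wprod.induct) (simp_all add: matrix_mul_assoc)

lemma det_wprod:
  assumes "det A = 1" "det B = 1"
  shows "det (wprod A B w) = 1"
proof (induction w)
  case (Cons l w)
  then show ?case using assms by (cases l) (simp_all add: det_mul)
qed simp

lemma trace_wprod_commute: "trace (wprod A B (u @ v)) = trace (wprod A B (v @ u))"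
  unfolding wprod_append by (rule trace_mul_sym)

definition real_mat :: "imat \<Rightarrow> real^2^2" where
  "real_mat M = (\<chi> i j. real_of_int (M $ i $ j))"

lemma real_mat_nth [simp]: "real_mat M $ i $ j = real_of_int (M $ i $ j)"
  by (simp add: real_mat_def)

lemma real_mat_mult: "real_mat (M ** N) = real_mat M ** real_mat N"
  by (simp add: vec_eq_iff mult2_nth)

lemma real_mat_phi: "real_mat (phi A B w) = wprod (real_mat A) (real_mat B) w"
proof (induction w)
  case Nil
  show ?case by (simp add: phi_def vec_eq_iff mat_def)
next
  case (Cons x w)
  then show ?case by (cases x) (simp_all add: phi_def real_mat_mult)
qed

lemma trace_real_mat: "trace (real_mat M) = real_of_int (trace M)"
  by (simp add: trace_2)

lemma det_real_mat: "det (real_mat M) = real_of_int (det M)"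
  by (simp add: det_2)

lemma wtr_eq_trace_wprod: "real_of_int (wtr A B w) = trace (wprod (real_mat A) (real_mat B) w)"
  unfolding wtr_def real_mat_phi[symmetric] trace_real_mat ..

text \<open>By Cayley--Hamilton, left multiplication by \<open>A\<close> and by \<open>B\<close> acts on the span of
  \<open>1, A, B, AB\<close> with coefficients that involve only the three traces.\<close>

definition span4 :: "real^2^2 \<Rightarrow> real^2^2 \<Rightarrow> real \<Rightarrow> real \<Rightarrow> real \<Rightarrow> real \<Rightarrow> real^2^2" where
  "span4 A B x y u v = mat2 x 0 0 x + y *\<^sub>R A + u *\<^sub>R B + v *\<^sub>R (A ** B)"

lemma mult_span4_left:
  assumes "det A = 1"
  shows "A ** span4 A B x y u v = span4 A B (- y) (x + y * trace A) (- v) (u + v * trace A)"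
proof -
  \<comment> \<open>Keeping the error as a multiple of \<open>1 - det A\<close> turns the claim into
    a polynomial identity in the entries, valid for all matrices.\<close>
  have "A ** span4 A B x y u v - span4 A B (- y) (x + y * trace A) (- v) (u + v * trace A)
      = (1 - det A) *\<^sub>R span4 A B y 0 v 0"
    by (rule mat2_eqI)
      (simp_all add: span4_def mult2_nth trace_2 det_2 algebra_simps)
  then show ?thesis using assms by simp
qed

text \<open>The coefficients come from Cayley-Hamilton for \<open>B\<close> and its polarised form
  AB + BA = tr(B) A + tr(A) B + (tr(AB) - tr(A) tr(B)) 1, which moves \<open>B\<close> past
  \<open>A\<close>.\<close>

lemma mult_span4_right:
  assumes "det B = 1"
  shows "B ** span4 A B x y u v =
    span4 A B (y * (trace (A ** B) - trace A * trace B) - u - v * trace A) (y * trace B + v)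
      (x + y * trace A + u * trace B + v * trace (A ** B)) (- y)"
proof -
  have "B ** span4 A B x y u v -
    span4 A B (y * (trace (A ** B) - trace A * trace B) - u - v * trace A) (y * trace B + v)
      (x + y * trace A + u * trace B + v * trace (A ** B)) (- y)
      = (1 - det B) *\<^sub>R span4 A B (u + v * trace A) (- v) 0 0"
    by (rule mat2_eqI)
      (simp_all add: span4_def mult2_nth trace_2 det_2 algebra_simps)
  then show ?thesis using assms by simp
qed

text \<open>Both pairs start with the same coefficients at the empty word and obey the same
  recursion, hence one existential covers both equations.\<close>

lemma wprod_span4:
  assumes "det A = 1" "det B = 1" "det A' = 1" "det B' = 1"
    and "trace A = trace A'" "trace B = trace B'" "trace (A ** B) = trace (A' ** B')"
  shows "\<exists>x y u v. wprod A B w = span4 A B x y u v \<and> wprod A' B' w = span4 A' B' x y u v"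
proof (induction w)
  case Nil
  have "wprod C D [] = span4 C D 1 0 0 0" for C D
    by (rule mat2_eqI) (simp_all add: span4_def mat1_nth)
  then show ?case by blast
next
  case (Cons l w)
  then obtain x y u v where "wprod A B w = span4 A B x y u v" "wprod A' B' w = span4 A' B' x y u v"
    by blast
  then show ?case
    using assms by (cases l) (auto simp: mult_span4_left mult_span4_right)
qed

lemma trace_wprod_cong:
  assumes "det A = 1" "det B = 1" "det A' = 1" "det B' = 1"
    and "trace A = trace A'" "trace B = trace B'" "trace (A ** B) = trace (A' ** B')"
  shows "trace (wprod A B w) = trace (wprod A' B' w)"
proof -
  have tr: "trace (span4 C D x y u v) = 2 * x + y * trace C + u * trace D + v * trace (C ** D)"
    for C D x y u v
    by (simp add: span4_def trace_2 algebra_simps)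
  show ?thesis
    using wprod_span4[OF assms, of w] assms by (auto simp: tr)
qed

subsection \<open>Nonnegative matrices with positive diagonal\<close>

text \<open>This class contains the identity and is closed under products; the positive diagonal is
  what keeps strict inequalities strict under multiplication.\<close>

definition pos_diag :: "real^2^2 \<Rightarrow> bool" where
  "pos_diag M \<longleftrightarrow> 0 < M$1$1 \<and> 0 \<le> M$1$2 \<and> 0 \<le> M$2$1 \<and> 0 < M$2$2"

lemma pos_diag_mat1: "pos_diag (mat 1)"
  by (simp add: pos_diag_def mat1_nth)

lemma pos_diag_mult: "pos_diag M \<Longrightarrow> pos_diag N \<Longrightarrow> pos_diag (M ** N)"
  by (simp add: pos_diag_def mult2_nth add_pos_nonneg add_nonneg_pos)

lemma pos_diag_wprod: "pos_diag A \<Longrightarrow> pos_diag B \<Longrightarrow> pos_diag (wprod A B w)"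
  by (induction A B w rule: wprod.induct) (simp_all add: pos_diag_mat1 pos_diag_mult)

lemma trace_mult_strict_mono:
  assumes "\<And>i j. M$i$j < N$i$j" and V: "pos_diag V"
  shows "trace (M ** V) < trace (N ** V)"
proof -
  have "M$1$1 * V$1$1 < N$1$1 * V$1$1" "M$2$2 * V$2$2 < N$2$2 * V$2$2"
    "M$1$2 * V$2$1 \<le> N$1$2 * V$2$1" "M$2$1 * V$1$2 \<le> N$2$1 * V$1$2"
    using assms less_imp_le[OF assms(1)] by (auto simp: pos_diag_def intro!: mult_right_mono)
  then show ?thesis by (simp add: trace_2 mult2_nth)
qed

section \<open>Row vectors and trace bounds\<close>

lemma row_mult_nth: "((f :: real^2) v* M) $ j = f$1 * M$1$j + f$2 * M$2$j"
  by (simp add: vector_matrix_mult_def sum_2 mult.commute)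

lemma row_mult_strict_mono:
  assumes "\<And>j. f$j < g$j" "pos_diag M"
  shows "(f v* M) $ j < (g v* M) $ j"
proof -
  have "f$i * M$i$j \<le> g$i * M$i$j" for i
    using assms(2) less_imp_le[OF assms(1)] exhaust_2[of i] exhaust_2[of j]
    by (auto simp: pos_diag_def intro!: mult_right_mono)
  moreover have "f$j * M$j$j < g$j * M$j$j"
    using assms exhaust_2[of j] by (auto simp: pos_diag_def)
  ultimately show ?thesis
    using exhaust_2[of j]
    by (auto simp: row_mult_nth intro: add_less_le_mono add_le_less_mono)
qed

text \<open>Multiplying the two column inequalities shows that the characteristic polynomial
  (\<sigma> - M11)(\<sigma> - M22) - M12 M21 is positive at \<sigma>. Dividing by \<sigma> gives the
  bound.\<close>

lemma trace_less_of_row_less: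
  fixes f :: "real^2"
  assumes f: "\<And>j. 0 < f$j" and M: "pos_diag M" and "0 < \<sigma>"
    and less: "\<And>j. (f v* M) $ j < \<sigma> * f$j"
  shows "trace M < \<sigma> + det M / \<sigma>"
proof -
  have 1: "f$2 * M$2$1 < f$1 * (\<sigma> - M$1$1)" and 2: "f$1 * M$1$2 < f$2 * (\<sigma> - M$2$2)"
    using less[of 1] less[of 2] by (simp_all add: row_mult_nth algebra_simps)
  have "(f$2 * M$2$1) * (f$1 * M$1$2) < (f$1 * (\<sigma> - M$1$1)) * (f$2 * (\<sigma> - M$2$2))"
    using f[of 1] f[of 2] M by (intro mult_strict_mono'[OF 1 2]) (auto simp: pos_diag_def)
  then have "(f$1 * f$2) * (M$2$1 * M$1$2) < (f$1 * f$2) * ((\<sigma> - M$1$1) * (\<sigma> - M$2$2))"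
    by (simp add: mult_ac)
  then have "M$2$1 * M$1$2 < (\<sigma> - M$1$1) * (\<sigma> - M$2$2)"
    using f[of 1] f[of 2] by (meson mult_less_cancel_left_pos mult_pos_pos)
  then have "trace M * \<sigma> < \<sigma> * \<sigma> + det M"
    by (simp add: trace_2 det_2 algebra_simps)
  then show ?thesis using \<open>0 < \<sigma>\<close> by (simp add: field_simps)
qed

text \<open>Here \<open>f\<close> is a left eigenvector, and \<sigma> and
  \<open>det M / \<sigma>\<close> are the two eigenvalues.\<close>

lemma trace_eq_of_row_eq:
  fixes f :: "real^2"
  assumes f: "\<And>j. 0 < f$j" and "0 < \<sigma>" and eq: "\<And>j. (f v* M) $ j = \<sigma> * f$j"
  shows "trace M = \<sigma> + det M / \<sigma>"
proof -
  have 1: "f$2 * M$2$1 = f$1 * (\<sigma> - M$1$1)" and 2: "f$1 * M$1$2 = f$2 * (\<sigma> - M$2$2)"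
    using eq[of 1] eq[of 2] by (simp_all add: row_mult_nth algebra_simps)
  have "(f$2 * M$2$1) * (f$1 * M$1$2) = (f$1 * (\<sigma> - M$1$1)) * (f$2 * (\<sigma> - M$2$2))"
    unfolding 1 2 ..
  then have "(f$1 * f$2) * (M$2$1 * M$1$2) = (f$1 * f$2) * ((\<sigma> - M$1$1) * (\<sigma> - M$2$2))"
    by (simp add: mult_ac)
  then have "M$2$1 * M$1$2 = (\<sigma> - M$1$1) * (\<sigma> - M$2$2)"
    using f[of 1] f[of 2] by simp
  then have "trace M * \<sigma> = \<sigma> * \<sigma> + det M"
    by (simp add: trace_2 det_2 algebra_simps)
  then show ?thesis using \<open>0 < \<sigma>\<close> by (simp add: field_simps)
qed

subsection \<open>Combinatorics of words\<close>

lemma wpow_Suc: "wpow w (Suc n) = w @ wpow w n"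
  by (simp add: wpow_def)

lemma wpow_0 [simp]: "wpow w 0 = []"
  by (simp add: wpow_def)

lemma length_wpow [simp]: "length (wpow w n) = n * length w"
  by (induction n) (simp_all add: wpow_Suc)

lemma count_list_wpow: "count_list (wpow w n) x = n * count_list w x"
  by (induction n) (simp_all add: wpow_Suc)

lemma count_list_rotate: "count_list (rotate k w) x = count_list w x"
proof (induction k)
  case (Suc k)
  have "count_list (rotate1 v) x = count_list v x" for v by (cases v) auto
  then show ?case using Suc by simp
qed simp

lemma wpow_append_commute: "wpow (u @ v) n @ u = u @ wpow (v @ u) n"
  by (induction n) (simp_all add: wpow_Suc)

lemma wpow_add: "wpow w (m + n) = wpow w m @ wpow w n"
  by (simp add: wpow_def replicate_add)

lemma rotate1_wpow: "rotate1 (wpow w n) = wpow (rotate1 w) n"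
proof (cases "w = [] \<or> n = 0")
  case True
  then show ?thesis by (auto simp: wpow_def)
next
  case False
  then obtain x v k where [simp]: "w = x # v" "n = Suc k"
    by (cases w; cases n) auto
  have "wpow ([x] @ v) k @ [x] = [x] @ wpow (v @ [x]) k"
    by (rule wpow_append_commute)
  then show ?thesis by (simp add: wpow_Suc)
qed

lemma rotate_wpow: "rotate k (wpow w n) = wpow (rotate k w) n"
  by (induction k) (simp_all add: rotate1_wpow)

section \<open>Factorization into the words ab and b\<close>

fun tok :: "bool \<Rightarrow> letter list" where
  "tok True = [La, Lb]"
| "tok False = [Lb]"

text \<open>If every a is followed at once by b, the word splits into ab and b. Otherwise some block
  of at least two a's occurs, and the final b ensures that it is followed by b.\<close>

lemma tokenize_or_aab:
  assumes "v = [] \<or> last v = Lb"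
  shows "(\<exists>ts. v = concat (map tok ts)) \<or> (\<exists>p q. v = p @ [La, La, Lb] @ q)"
  using assms
proof (induction v)
  case Nil
  have "[] = concat (map tok [])" by simp
  then show ?case by blast
next
  case (Cons x v)
  have IH: "(\<exists>ts. v = concat (map tok ts)) \<or> (\<exists>p q. v = p @ [La, La, Lb] @ q)"
    using Cons by (cases v) auto
  show ?case
  proof (cases "\<exists>p q. v = p @ [La, La, Lb] @ q")
    case True
    then obtain p q where "x # v = (x # p) @ [La, La, Lb] @ q" by auto
    then show ?thesis by blast
  next
    case False
    then obtain ts where ts: "v = concat (map tok ts)" using IH by blast
    show ?thesis
    proof (cases x)
      case Lb
      then have "x # v = concat (map tok (False # ts))" using ts by simp
      then show ?thesis by blast
    next
      case La
      \<comment> \<open>The word ends in b, so its leading a is not its last letter.\<close>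
      then have "ts \<noteq> []" using Cons.prems ts by auto
      then obtain k ks where k: "ts = k # ks" by (cases ts) auto
      show ?thesis
      proof (cases k)
        case True
        then have "x # v = [] @ [La, La, Lb] @ concat (map tok ks)" using ts k La by simp
        then show ?thesis by blast
      next
        case False
        then have "x # v = concat (map tok (True # ks))" using ts k La by simp
        then show ?thesis by blast
      qed
    qed
  qed
qed

text \<open>\<open>st\<close> is the token read before the list. Taking it to be the last token of
  the list makes the condition cyclic.\<close>

fun alternates :: "bool \<Rightarrow> bool list \<Rightarrow> bool" where
  "alternates st [] \<longleftrightarrow> True"
| "alternates st (k # ks) \<longleftrightarrow> k \<noteq> st \<and> alternates k ks"

fun final :: "bool \<Rightarrow> bool list \<Rightarrow> bool" where
  "final st [] = st"
| "final st (k # ks) = final k ks"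

lemma final_last: "ts \<noteq> [] \<Longrightarrow> final st ts = last ts"
  by (induction st ts rule: final.induct) (auto split: if_splits)

text \<open>Returning to \<open>st\<close> forces an even number of tokens, so the induction removes
  two at a time.\<close>

lemma alternates_cyclic:
  "alternates st ts \<Longrightarrow> final st ts = st \<Longrightarrow>
    \<exists>n. concat (map tok ts) = wpow (tok (\<not> st) @ tok st) n"
proof (induction ts rule: length_induct)
  case (1 ts)
  show ?case
  proof (cases ts)
    case Nil
    then have "concat (map tok ts) = wpow (tok (\<not> st) @ tok st) 0" by simp
    then show ?thesis by blast
  next
    case (Cons k ks)
    \<comment> \<open>A single token would leave \<open>final\<close> at \<open>\<not> st\<close>,
      so a second one exists.\<close>
    then obtain ks' where ks: "ks = st # ks'" and k: "k = (\<not> st)"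
      using 1(2,3) by (cases ks) auto
    then obtain n where "concat (map tok ks') = wpow (tok (\<not> st) @ tok st) n"
      using 1(1)[rule_format, of ks'] 1(2,3) Cons by auto
    then have "concat (map tok ts) = wpow (tok (\<not> st) @ tok st) (Suc n)"
      using Cons ks k by (simp add: wpow_Suc)
    then show ?thesis by blast
  qed
qed

lemma wpow_tokens_eq_rotate: "\<exists>j. wpow (tok (\<not> st) @ tok st) n = wpow (rotate j [La, Lb, Lb]) n"
proof (cases st)
  case True
  then have "tok (\<not> st) @ tok st = rotate 2 [La, Lb, Lb]" by (simp add: numeral_2_eq_2)
  then show ?thesis by metis
next
  case False
  then have "tok (\<not> st) @ tok st = rotate 0 [La, Lb, Lb]" by simp
  then show ?thesis by metis
qed

text \<open>Counting the letter a shows that 3 divides the length of \<open>w\<close>; comparing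
  prefixes of that length then identifies \<open>w\<close>.\<close>

lemma wpow3_eq_rotate_abb:
  assumes "wpow w 3 = wpow (rotate j [La, Lb, Lb]) (length w)"
  shows "\<exists>n. w = wpow (rotate j [La, Lb, Lb]) n"
proof -
  have count: "count_list (rotate j [La, Lb, Lb]) La = 1"
    by (simp add: count_list_rotate)
  have "3 * count_list w La = length w"
    using arg_cong[OF assms, of "\<lambda>u. count_list u La"] by (simp only: count_list_wpow count)
  then obtain n where n: "length w = n * 3" by (metis mult.commute)
  have "w @ wpow w 2 = wpow (rotate j [La, Lb, Lb]) n @ wpow (rotate j [La, Lb, Lb]) (2 * n)"
  proof -
    have "w @ wpow w 2 = wpow w 3" by (metis wpow_Suc numeral_3_eq_3 numeral_2_eq_2)
    moreover have "length w = n + 2 * n" using n by simp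
    ultimately show ?thesis using assms by (metis wpow_add)
  qed
  then have "w = wpow (rotate j [La, Lb, Lb]) n"
    using n by simp
  then show ?thesis ..
qed

subsection \<open>The maximal trace\<close>

text \<open>The witness is the larger root of X^2 - xX + 1, the leading eigenvalue of a matrix of
  determinant 1 and trace \<open>x\<close>.\<close>

lemma exists_add_inverse:
  fixes x :: real
  assumes "2 \<le> x"
  shows "\<exists>a\<ge>1. a + 1 / a = x"
proof -
  define r where "r = sqrt (x\<^sup>2 - 4)"
  have "2\<^sup>2 \<le> x\<^sup>2" using assms by (intro power_mono) auto
  then have r: "0 \<le> r" "r\<^sup>2 = x\<^sup>2 - 4" by (simp_all add: r_def)
  have "(x + r) / 2 \<ge> 1" using assms r by simp
  moreover have "(x + r) / 2 + 1 / ((x + r) / 2) = x"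
  proof -
    have "x + r \<noteq> 0" using assms r by simp
    then show ?thesis using r by (simp add: field_simps power2_eq_square)
  qed
  ultimately show ?thesis by blast
qed

text \<open>The difference of the two sums is (b - a)(ab - 1)/(ab), so traces compare as leading
  eigenvalues do.\<close>

lemma add_inverse_less_iff:
  fixes a b :: real
  assumes "1 \<le> a" "1 \<le> b"
  shows "a + 1 / a < b + 1 / b \<longleftrightarrow> a < b"
proof -
  have mono: "x + 1 / x < y + 1 / y" if "1 \<le> x" "x < y" for x y :: real
  proof -
    have "1 * 1 < x * y" using that by (intro mult_le_less_imp_less) auto
    then have "0 < (y - x) * (x * y - 1)" using that by simp
    then show ?thesis using that by (simp add: field_simps)
  qed
  then show ?thesis using assms
    by (metis less_asym less_linear order.asym)
qed

text \<open>Here \<open>\<mu>\<close> is the leading eigenvalue of \<open>B\<close>, with inverse \<open>m\<close>, and \<open>\<tau>\<^sup>3\<close> that of \<open>AB\<^sup>2\<close>.\<close>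

locale trace_data =
  fixes A B :: "real^2^2" and s t \<mu> m \<tau> :: real
  assumes det_A: "det A = 1" and det_B: "det B = 1"
    and trace_A: "trace A = s" and trace_B: "trace B = t" and trace_AB: "trace (A ** B) = t\<^sup>2 - 2"
    and s_ge: "2 \<le> s" and s_le: "s + 1 \<le> t"
    and \<mu>_gt: "1 < \<mu>" and \<mu>_m: "\<mu> * m = 1" and \<mu>_add_m: "\<mu> + m = t"
    and \<tau>_gt: "1 < \<tau>" and \<tau>_add: "\<tau> ^ 3 + 1 / \<tau> ^ 3 = t ^ 3 - 2 * t - s"
begin

abbreviation wt :: "letter list \<Rightarrow> real" where
  "wt w \<equiv> trace (wprod A B w)"

lemma m_bounds: "0 < m" "m < 1"
proof -
  show "0 < m" using \<mu>_gt \<mu>_m by (metis less_trans zero_less_mult_pos zero_less_one)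
  then have "m * 1 < m * \<mu>" using \<mu>_gt by (intro mult_strict_left_mono) auto
  then show "m < 1" using \<mu>_m by (simp add: mult.commute)
qed

text \<open>The gap of at least 1 between the integer traces exceeds \<open>m\<close>.\<close>

lemma s_less_\<mu>: "s < \<mu>"
  using s_le \<mu>_add_m m_bounds by linarith

lemma wt_cong:
  assumes "det A' = 1" "det B' = 1" "trace A' = s" "trace B' = t" "trace (A' ** B') = t\<^sup>2 - 2"
  shows "wt w = trace (wprod A' B' w)"
  using assms det_A det_B trace_A trace_B trace_AB by (intro trace_wprod_cong) auto

text \<open>The trace t^3 - 3t of B^3 is smaller than the trace t^3 - 2t - s of AB^2 because s < t;
  the leading eigenvalues compare accordingly.\<close>

lemma \<mu>_less_\<tau>: "\<mu> < \<tau>"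
proof -
  have inv: "1 / \<mu> = m" using \<mu>_m \<mu>_gt by (simp add: field_simps)
  have "(\<mu> + m) ^ 3 = \<mu> ^ 3 + m ^ 3 + 3 * (\<mu> * m) * (\<mu> + m)"
    by (simp add: power3_eq_cube algebra_simps)
  then have "\<mu> ^ 3 + m ^ 3 = t ^ 3 - 3 * t"
    by (simp add: \<mu>_m \<mu>_add_m)
  then have "\<mu> ^ 3 + 1 / \<mu> ^ 3 < \<tau> ^ 3 + 1 / \<tau> ^ 3"
    using s_le \<tau>_add inv by (simp flip: power_one_over)
  then have "\<mu> ^ 3 < \<tau> ^ 3"
    using add_inverse_less_iff[of "\<mu> ^ 3" "\<tau> ^ 3"] \<mu>_gt \<tau>_gt by simp
  then show ?thesis
    using \<tau>_gt by (meson less_le_trans zero_less_one less_imp_le power_less_imp_less_base)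
qed

text \<open>In the basis of the attracting eigenvectors both generators are triangular and nonnegative,
  and there \<open>A\<^sup>2B\<close> is entrywise smaller than \<open>AB\<^sup>2\<close>.\<close>

lemma triangular_model:
  obtains l l' p where "1 \<le> l" "l < \<mu>" "l * l' = 1"
    "\<And>w. wt w = trace (wprod (mat2 l p 0 l') (mat2 m 0 1 \<mu>) w)"
    "pos_diag (mat2 l p 0 l')" "pos_diag (mat2 m 0 1 \<mu>)"
    "\<And>i j. (mat2 l p 0 l' ** mat2 l p 0 l' ** mat2 m 0 1 \<mu>)$i$j
      < (mat2 l p 0 l' ** mat2 m 0 1 \<mu> ** mat2 m 0 1 \<mu>)$i$j"
proof -
  obtain l where l: "1 \<le> l" "l + 1 / l = s"
    using exists_add_inverse s_ge by blast
  define l' where "l' = 1 / l"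
  \<comment> \<open>This value of \<open>p\<close> is forced by the trace t^2 - 2 of the product of
    the two triangular matrices.\<close>
  define p where "p = t\<^sup>2 - 2 - l * m - \<mu> * l'"
  have ll': "l * l' = 1" and sum: "l + l' = s" and l': "0 < l'" "l' \<le> 1"
    using l by (simp_all add: l'_def)
  have l_less: "l < \<mu>" using sum l' s_less_\<mu> by linarith
  have lm: "l * m < 1"
    using mult_strict_right_mono[OF l_less m_bounds(1)] by (simp add: \<mu>_m)
  \<comment> \<open>This is (l - 1)(\<mu> - lm) \<ge> 0, multiplied by \<open>l'\<close> and
    rearranged. It bounds \<open>p\<close> from below.\<close>
  have "l * m + \<mu> * l' \<le> t"
  proof -
    have "(l - 1) * (l * m) \<le> (l - 1) * \<mu>"
      using l lm \<mu>_gt by (intro mult_left_mono) auto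
    then have "l' * ((l - 1) * (l * m)) \<le> l' * ((l - 1) * \<mu>)"
      using l' by simp
    moreover have "l' * ((l - 1) * (l * m)) = l * m - m" "l' * ((l - 1) * \<mu>) = \<mu> - \<mu> * l'"
      using ll' by algebra+
    ultimately show ?thesis
      using \<mu>_add_m by linarith
  qed
  moreover have "t\<^sup>2 \<ge> 3 * t"
    using s_ge s_le by (simp add: power2_eq_square)
  ultimately have p_gt: "t < p"
    using s_ge s_le unfolding p_def by linarith
  then have p: "\<mu> < p" "0 < p"
    using \<mu>_add_m m_bounds \<mu>_gt by linarith+
  let ?A = "mat2 l p 0 l'" and ?B = "mat2 m 0 1 \<mu>"
  show thesis
  proof (rule that[of l l' p])
    show "wt w = trace (wprod ?A ?B w)" for w
      by (rule wt_cong) (simp_all add: det_2 trace_2 mult2_nth ll' sum \<mu>_m mult.commute[of m]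
          add.commute[of m] \<mu>_add_m p_def)
    show "pos_diag ?A" "pos_diag ?B"
      using l l' p m_bounds \<mu>_gt by (simp_all add: pos_diag_def)
    show "(?A ** ?A ** ?B)$i$j < (?A ** ?B ** ?B)$i$j" for i j
    proof -
      \<comment> \<open>The gain p(t - s) is at least \<open>p\<close>, which exceeds \<mu> and
        hence the possible loss l^2 m < l.\<close>
      have 11: "(?A ** ?A ** ?B)$1$1 < (?A ** ?B ** ?B)$1$1"
      proof -
        have "l * l * m < l" using mult_strict_left_mono[OF lm, of l] l by (simp add: mult.assoc)
        moreover have "p * s + p * 1 \<le> p * t"
          using mult_left_mono[OF s_le, of p] p by (simp add: distrib_left)
        moreover have "0 < l * m * m" using l m_bounds by simp
        ultimately have "l * l * m + p * s < l * m * m + p * t"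
          using l_less p by linarith
        then show ?thesis
          by (simp add: mult2_nth algebra_simps flip: sum \<mu>_add_m)
      qed
      have 12: "(?A ** ?A ** ?B)$1$2 < (?A ** ?B ** ?B)$1$2"
      proof -
        have "(p * \<mu>) * s < (p * \<mu>) * \<mu>"
          using s_less_\<mu> p \<mu>_gt by (intro mult_strict_left_mono) auto
        then show ?thesis
          by (simp add: mult2_nth algebra_simps flip: sum)
      qed
      have 21: "(?A ** ?A ** ?B)$2$1 < (?A ** ?B ** ?B)$2$1"
      proof -
        have "l' * l' < l' * t"
          using l' s_ge s_le by (intro mult_strict_left_mono) auto
        then show ?thesis
          by (simp add: mult2_nth algebra_simps flip: \<mu>_add_m)
      qed
      have 22: "(?A ** ?A ** ?B)$2$2 < (?A ** ?B ** ?B)$2$2"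
      proof -
        have "(l' * \<mu>) * l' < (l' * \<mu>) * \<mu>"
          using l' \<mu>_gt by (intro mult_strict_left_mono) auto
        then show ?thesis by (simp add: mult2_nth algebra_simps)
      qed
      show ?thesis
        using 11 12 21 22 exhaust_2[of i] exhaust_2[of j] by blast
    qed
  qed (fact l l_less ll')+
qed

text \<open>After a cyclic shift the three letters come first, and the entrywise inequality of the
  triangular model is multiplied by a matrix with positive diagonal.\<close>

lemma wt_aab_less: "wt (p @ [La, La, Lb] @ q) < wt (p @ [La, Lb, Lb] @ q)"
proof -
  obtain A' B' where *: "\<And>w. wt w = trace (wprod A' B' w)" "pos_diag A'" "pos_diag B'"
    "\<And>i j. (A' ** A' ** B')$i$j < (A' ** B' ** B')$i$j"
    using triangular_model by metis
  have rot: "wt (p @ u @ q) = trace (wprod A' B' u ** wprod A' B' (q @ p))" for u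
    using trace_wprod_commute[of A' B' p "u @ q"] unfolding *(1) by (simp add: wprod_append)
  show ?thesis
    unfolding rot using trace_mult_strict_mono[OF *(4) pos_diag_wprod[OF *(2,3)], of "q @ p"]
    by (simp add: matrix_mul_assoc)
qed

text \<open>Powers of a have no rotation ending in b and so escape the factorization. In the
  triangular model their traces are read off from the diagonal.\<close>

lemma wt_replicate_a_less:
  assumes "0 < n"
  shows "wt (replicate (3 * n) La) < (\<tau> ^ 3) ^ n + 1 / (\<tau> ^ 3) ^ n"
proof -
  obtain l l' p B' where l: "1 \<le> l" "l < \<mu>" "l * l' = 1"
    and *: "\<And>w. wt w = trace (wprod (mat2 l p 0 l') B' w)"
    using triangular_model by metis
  have "wprod (mat2 l p 0 l') B' (replicate k La) $ 2 $ 1 = 0 \<and>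
    wprod (mat2 l p 0 l') B' (replicate k La) $ 1 $ 1 = l ^ k \<and>
    wprod (mat2 l p 0 l') B' (replicate k La) $ 2 $ 2 = l' ^ k" for k
    by (induction k) (simp_all add: mult2_nth mat1_nth)
  then have "wt (replicate (3 * n) La) = l ^ (3 * n) + l' ^ (3 * n)"
    unfolding * by (simp add: trace_2)
  also have "l' = 1 / l" using l by (simp add: field_simps)
  also have "l ^ (3 * n) + (1 / l) ^ (3 * n) = l ^ (3 * n) + 1 / l ^ (3 * n)"
    by (simp add: power_one_over)
  also have "\<dots> < \<tau> ^ (3 * n) + 1 / \<tau> ^ (3 * n)"
    using l \<tau>_gt \<mu>_less_\<tau> assms
    by (subst add_inverse_less_iff) (auto intro!: power_strict_mono)
  finally show ?thesis by (simp add: power_mult)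
qed

text \<open>\<open>F k\<close> is the row reached after token \<open>k\<close>. A change of token
  scales it exactly by \<tau> per letter, while a repeated token scales it by strictly less.\<close>

lemma token_model:
  obtains A' B' and F :: "bool \<Rightarrow> real^2"
  where "\<And>w. wt w = trace (wprod A' B' w)" "det A' = 1" "det B' = 1"
    "\<And>k. pos_diag (wprod A' B' (tok k))" "\<And>k j. 0 < F k $ j"
    "\<And>k j. (F (\<not> k) v* wprod A' B' (tok k)) $ j = \<tau> ^ length (tok k) * F k $ j"
    "\<And>k j. (F k v* wprod A' B' (tok k)) $ j < \<tau> ^ length (tok k) * F k $ j"
proof -
  \<comment> \<open>\<open>h\<close> makes \<open>A'\<close>, the first token matrix times the
    inverse of the second, have trace \<open>s\<close>. \<open>G\<close> and \<open>y\<close> solve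
    the two columns of the equation \<open>F True v* B' = \<tau> *\<^sub>R F False\<close>.\<close>
  define h where "h = (1 - s * m ^ 3 + m ^ 6) / (1 - m\<^sup>2)"
  define G where "G = (\<tau> ^ 3 - \<mu>) / (\<mu> - m)"
  define y where "y = \<mu> * G / \<tau> ^ 3"
  \<comment> \<open>The lower left entry is negative; only the matrices of the tokens need to be
    nonnegative.\<close>
  define A' where "A' = mat2 (s - m ^ 3) (\<mu> * h) (- (m - m ^ 3)) (m ^ 3)"
  define B' where "B' = mat2 m 0 (\<mu> - m) \<mu>"
  define F :: "bool \<Rightarrow> real^2" where
    "F k = (if k then vector [\<mu>\<^sup>2 / \<tau>\<^sup>2, G / \<tau>\<^sup>2] else vector [1, y])" for k
  have m2: "0 < 1 - m\<^sup>2" using m_bounds by (simp add: power_less_one_iff)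
  have \<mu>m: "0 < \<mu> - m" using \<mu>_gt m_bounds by simp
  have \<tau>3: "\<mu> < \<tau> ^ 3"
    using \<mu>_less_\<tau> \<tau>_gt power_increasing[of 1 3 \<tau>] by simp
  have h_eq: "h * (1 - m\<^sup>2) = 1 - s * m ^ 3 + m ^ 6"
    using m2 by (simp add: h_def)
  have "s * m ^ 3 < 1"
  proof -
    have "s * m ^ 3 < \<mu> * m ^ 3" using s_less_\<mu> m_bounds by simp
    also have "\<dots> = m\<^sup>2" using \<mu>_m by (simp add: power3_eq_cube power2_eq_square)
    finally show ?thesis using m2 by simp
  qed
  moreover have "0 < m ^ 6" using m_bounds by simp
  ultimately have "0 < 1 - s * m ^ 3 + m ^ 6" by linarith
  then have h: "0 < h" unfolding h_def using m2 by (rule divide_pos_pos)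
  have \<tau>_gt_2: "2 < \<tau>" using s_ge s_less_\<mu> \<mu>_less_\<tau> by linarith
  have G: "0 < G" and y: "0 < y"
    using \<tau>3 \<mu>m \<mu>_gt \<tau>_gt by (simp_all add: G_def y_def)
  have G_mult: "G * (\<mu> - m) = \<tau> ^ 3 - \<mu>" using \<mu>m by (simp add: G_def)
  have y_mult: "y * \<tau> ^ 3 = \<mu> * G" using \<tau>_gt by (simp add: y_def)
  have X: "wprod A' B' (tok True) = mat2 (\<mu>\<^sup>2) (\<mu>\<^sup>2 * h) 0 (m\<^sup>2)"
  proof -
    have "(s - m ^ 3) * m + \<mu> * h * (\<mu> - m) = \<mu>\<^sup>2"
      using h_eq \<mu>_m by algebra
    moreover have "- (m - m ^ 3) * m + m ^ 3 * (\<mu> - m) = 0" "m ^ 3 * \<mu> = m\<^sup>2"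
      using \<mu>_m by algebra+
    ultimately show ?thesis
      by (intro mat2_eqI) (simp_all add: A'_def B'_def mult2_nth mat1_nth power2_eq_square)
  qed
  have Y: "wprod A' B' (tok False) = B'" by simp
  \<comment> \<open>The remaining column of the eigenvector equations. It encodes that the trace of
    AB^2 is \<tau>^3 + 1/\<tau>^3.\<close>
  have G_eq: "\<mu>\<^sup>2 * h + y * m\<^sup>2 = G"
  proof -
    have 1: "\<mu>\<^sup>2 * h * (\<mu> - m) = \<mu> ^ 3 - s + m ^ 3"
      using h_eq \<mu>_m by algebra
    have "y * (\<mu> - m) = \<mu> * (G * (\<mu> - m)) / \<tau> ^ 3"
      by (simp add: y_def)
    also have "\<dots> = \<mu> * (1 - \<mu> / \<tau> ^ 3)"
      unfolding G_mult using \<tau>_gt by (simp add: field_simps)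
    finally have 2: "y * m\<^sup>2 * (\<mu> - m) = m - 1 / \<tau> ^ 3"
      using \<mu>_m by algebra
    have 3: "\<mu> ^ 3 + m ^ 3 = t ^ 3 - 3 * t"
      using \<mu>_m \<mu>_add_m by algebra
    have "(\<mu>\<^sup>2 * h + y * m\<^sup>2) * (\<mu> - m) = G * (\<mu> - m)"
      using 1 2 3 G_mult \<tau>_add \<mu>_add_m by (simp add: distrib_right)
    then show ?thesis using \<mu>m by simp
  qed
  have diff3: "\<tau> ^ 3 - \<mu> ^ 3 = (\<tau> - \<mu>) * (\<tau>\<^sup>2 + \<tau> * \<mu> + \<mu>\<^sup>2)"
    by (simp add: power3_eq_cube power2_eq_square algebra_simps)
  \<comment> \<open>First column of the loss for bb. Multiplied by \<tau>^3 it acquires the factor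
    \<tau> - \<mu>, which leaves the inequality proved first.\<close>
  have YY: "m + y * (\<mu> - m) < \<tau>"
  proof -
    have "m * (\<tau>\<^sup>2 + \<tau> * \<mu> + \<mu>\<^sup>2) < \<tau> ^ 3"
    proof -
      have "m * (\<tau>\<^sup>2 + \<tau> * \<mu> + \<mu>\<^sup>2) = m * \<tau>\<^sup>2 + \<tau> + \<mu>"
        using \<mu>_m by algebra
      also have "\<dots> < \<tau> * \<tau>\<^sup>2"
      proof -
        have "2 * 1 < \<tau> * (\<tau> - m)"
          using \<tau>_gt_2 m_bounds by (intro mult_strict_mono) auto
        then have "\<tau> * 2 < \<tau> * (\<tau> * (\<tau> - m))" using \<tau>_gt by simp
        then show ?thesis
          using \<mu>_less_\<tau> by (simp add: power2_eq_square algebra_simps)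
      qed
      finally show ?thesis by (simp add: power3_eq_cube power2_eq_square)
    qed
    then have "(\<tau> - \<mu>) * (m * (\<tau>\<^sup>2 + \<tau> * \<mu> + \<mu>\<^sup>2)) < (\<tau> - \<mu>) * \<tau> ^ 3"
      using \<mu>_less_\<tau> by simp
    then have "m * (\<tau> ^ 3 - \<mu> ^ 3) < (\<tau> - \<mu>) * \<tau> ^ 3"
      unfolding diff3 by (simp add: mult_ac)
    then have "(m + \<mu>) * \<tau> ^ 3 - \<mu>\<^sup>2 < \<tau> * \<tau> ^ 3"
      using \<mu>_m by (simp add: algebra_simps power3_eq_cube power2_eq_square)
    moreover have "(m + y * (\<mu> - m)) * \<tau> ^ 3 = (m + \<mu>) * \<tau> ^ 3 - \<mu>\<^sup>2"
      using y_mult G_mult by algebra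
    ultimately have "(m + y * (\<mu> - m)) * \<tau> ^ 3 < \<tau> * \<tau> ^ 3" by simp
    then show ?thesis using \<tau>_gt by (auto dest: mult_right_less_imp_less)
  qed
  \<comment> \<open>Second column of the loss for abab. Eliminating \<open>h\<close> by
    \<open>G_eq\<close> and \<open>y\<close> by \<open>y_mult\<close> leaves the factors
    \<open>G\<close> and \<tau> - \<mu>.\<close>
  have XX: "\<mu>\<^sup>2 * \<mu>\<^sup>2 * h + G * m\<^sup>2 < \<tau>\<^sup>2 * G"
  proof -
    have "m\<^sup>2 * (\<tau>\<^sup>2 + \<tau> * \<mu> + \<mu>\<^sup>2) < (\<tau> + \<mu>) * \<tau> ^ 3"
    proof -
      have "m\<^sup>2 * (\<tau>\<^sup>2 + \<tau> * \<mu> + \<mu>\<^sup>2) < 1 * (\<tau> + \<mu>)\<^sup>2"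
        using m2 m_bounds \<tau>_gt \<mu>_gt
        by (intro mult_less_le_imp_less)
          (auto simp: power2_eq_square algebra_simps intro!: add_pos_pos)
      also have "\<dots> < (\<tau> + \<mu>) * \<tau> ^ 3"
      proof -
        have "2 * 1 < \<tau> * \<tau>"
          using \<tau>_gt_2 by (intro mult_strict_mono) auto
        then have "\<tau> * 2 < \<tau> * (\<tau> * \<tau>)" using \<tau>_gt by simp
        then have "\<tau> + \<mu> < \<tau> ^ 3" using \<mu>_less_\<tau> by (simp add: power3_eq_cube mult.assoc)
        then show ?thesis using \<tau>_gt \<mu>_gt by (simp add: power2_eq_square)
      qed
      finally show ?thesis .
    qed
    then have "(\<tau> - \<mu>) * (m\<^sup>2 * (\<tau>\<^sup>2 + \<tau> * \<mu> + \<mu>\<^sup>2)) < (\<tau> - \<mu>) * ((\<tau> + \<mu>) * \<tau> ^ 3)"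
      using \<mu>_less_\<tau> by simp
    then have "m\<^sup>2 * (\<tau> ^ 3 - \<mu> ^ 3) < (\<tau>\<^sup>2 - \<mu>\<^sup>2) * \<tau> ^ 3"
      unfolding diff3 by (simp add: mult_ac power2_eq_square algebra_simps)
    then have "0 < (\<tau>\<^sup>2 - \<mu>\<^sup>2 - m\<^sup>2) * \<tau> ^ 3 + m\<^sup>2 * \<mu> ^ 3"
      by (simp add: algebra_simps)
    also have "m\<^sup>2 * \<mu> ^ 3 = \<mu>" using \<mu>_m by algebra
    finally have "0 < G * ((\<tau>\<^sup>2 - \<mu>\<^sup>2 - m\<^sup>2) * \<tau> ^ 3 + \<mu>)"
      using G by simp
    also have "\<dots> = (\<tau>\<^sup>2 * G - (\<mu>\<^sup>2 * G - y + G * m\<^sup>2)) * \<tau> ^ 3"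
      using y_mult by algebra
    also have "\<mu>\<^sup>2 * G - y = \<mu>\<^sup>2 * \<mu>\<^sup>2 * h + y * ((\<mu> * m)\<^sup>2 - 1)"
      unfolding G_eq[symmetric] by algebra
    also have "\<dots> = \<mu>\<^sup>2 * \<mu>\<^sup>2 * h" by (simp add: \<mu>_m)
    finally show ?thesis using \<tau>_gt by (simp add: zero_less_mult_iff)
  qed
  have det_A': "det A' = 1"
    using h_eq \<mu>_m unfolding A'_def det_2 by (simp, algebra)
  have det_B': "det B' = 1"
    using \<mu>_m by (simp add: B'_def det_2 mult.commute)
  show thesis
  proof (rule that[of A' B' F])
    show "wt w = trace (wprod A' B' w)" for w
    proof (rule wt_cong)
      have "A' ** B' = wprod A' B' (tok True)" by simp
      then have "trace (A' ** B') = \<mu>\<^sup>2 + m\<^sup>2" unfolding X by (simp add: trace_2)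
      also have "\<dots> = t\<^sup>2 - 2" using \<mu>_m \<mu>_add_m by algebra
      finally show "trace (A' ** B') = t\<^sup>2 - 2" .
    qed (use det_A' det_B' \<mu>_add_m in \<open>simp_all add: A'_def B'_def trace_2\<close>)
    show "pos_diag (wprod A' B' (tok k))" for k
      using h \<mu>_gt \<mu>m m_bounds
      by (cases k) (simp_all only: X Y, simp_all add: B'_def pos_diag_def)
    show "0 < F k $ j" for k j
      using exhaust_2[of j] G y \<mu>_gt \<tau>_gt by (auto simp: F_def)
    show "(F (\<not> k) v* wprod A' B' (tok k)) $ j = \<tau> ^ length (tok k) * F k $ j" for k j
    proof (cases k)
      case True
      then show ?thesis
        using exhaust_2[of j] G_eq \<tau>_gt
        by (auto simp only: X row_mult_nth) (auto simp: F_def power2_eq_square)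
    next
      case False
      have "\<mu>\<^sup>2 * m + G * (\<mu> - m) = \<tau> ^ 3" "G * \<mu> = y * \<tau> ^ 3"
        using G_mult y_mult \<mu>_m by algebra+
      then show ?thesis
        using exhaust_2[of j] \<tau>_gt False
        by (auto simp: B'_def row_mult_nth F_def field_simps power2_eq_square power3_eq_cube)
    qed
    show "(F k v* wprod A' B' (tok k)) $ j < \<tau> ^ length (tok k) * F k $ j" for k j
    proof (cases k)
      case True
      have len: "\<tau> ^ length (tok k) = \<tau>\<^sup>2" using True by (simp add: power2_eq_square)
      have "\<mu>\<^sup>2 < \<tau>\<^sup>2" using \<mu>_less_\<tau> \<mu>_gt by (intro power_strict_mono) auto
      then have "\<mu>\<^sup>2 * \<mu>\<^sup>2 < \<tau>\<^sup>2 * \<mu>\<^sup>2"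
        using \<mu>_gt by (intro mult_strict_right_mono) auto
      from divide_strict_right_mono[OF this, of "\<tau>\<^sup>2"] divide_strict_right_mono[OF XX, of "\<tau>\<^sup>2"]
      show ?thesis
        unfolding len using exhaust_2[of j] \<tau>_gt True
        by (auto simp only: X row_mult_nth) (auto simp: F_def add_divide_distrib mult_ac)
    next
      case False
      then show ?thesis
        using exhaust_2[of j] YY \<mu>_less_\<tau> y
        by (auto simp: B'_def row_mult_nth F_def)
    qed
  qed (fact det_A' det_B')+
qed

text \<open>Following \<open>F\<close> through the tokens, each repetition loses strictly. Since the
  final state equals the initial one, \<open>F st\<close> is a left eigenvector or a strict
  subeigenvector of the whole product, and the trace bounds apply with determinant 1.\<close>

lemma wt_tokens:
  assumes "final st ts = st"
  shows "if alternates st ts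
    then wt (concat (map tok ts)) =
      \<tau> ^ length (concat (map tok ts)) + 1 / \<tau> ^ length (concat (map tok ts))
    else wt (concat (map tok ts)) <
      \<tau> ^ length (concat (map tok ts)) + 1 / \<tau> ^ length (concat (map tok ts))"
proof -
  obtain A' B' F where wt_eq: "\<And>w. wt w = trace (wprod A' B' w)"
    and det: "det A' = 1" "det B' = 1"
    and pos: "\<And>k. pos_diag (wprod A' B' (tok k))" and F: "\<And>k j. 0 < F k $ j"
    and step: "\<And>k j. (F (\<not> k) v* wprod A' B' (tok k)) $ j = \<tau> ^ length (tok k) * F k $ j"
    and loss: "\<And>k j. (F k v* wprod A' B' (tok k)) $ j < \<tau> ^ length (tok k) * F k $ j"
    by (rule token_model) blast
  let ?P = "\<lambda>ts. wprod A' B' (concat (map tok ts))"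
  let ?T = "\<lambda>ts. \<tau> ^ length (concat (map tok ts))"
  have pos_P: "pos_diag (?P ts)" for ts
    by (induction ts) (simp_all add: pos_diag_mat1 wprod_append pos pos_diag_mult)
  have T_pos: "0 < ?T ts" for ts using \<tau>_gt by simp
  have growth: "if alternates st ts then (\<forall>j. (F st v* ?P ts) $ j = ?T ts * F (final st ts) $ j)
    else (\<forall>j. (F st v* ?P ts) $ j < ?T ts * F (final st ts) $ j)" for st ts
  proof (induction ts arbitrary: st)
    case Nil
    show ?case by (simp add: row_mult_nth vector_matrix_mul_rid)
  next
    case (Cons k ks)
    let ?c = "\<tau> ^ length (tok k)"
    have c: "0 < ?c" using \<tau>_gt by simp
    have split: "F st v* ?P (k # ks) = (F st v* wprod A' B' (tok k)) v* ?P ks"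
      by (simp add: wprod_append vector_matrix_mul_assoc)
    have scale: "((?c *\<^sub>R F k) v* ?P ks) $ j = ?c * (F k v* ?P ks) $ j" for j
      by (simp add: row_mult_nth algebra_simps)
    have T: "?T (k # ks) = ?c * ?T ks" by (simp add: power_add)
    \<comment> \<open>The weak bound holds in both cases of the induction hypothesis and is enough
      after a strict loss.\<close>
    have IH_le: "?c * (F k v* ?P ks) $ j \<le> ?T (k # ks) * F (final k ks) $ j" for j
      using Cons.IH[of k] c unfolding T by (auto split: if_splits simp: mult.assoc less_imp_le)
    show ?case
    proof (cases "k = st")
      case True
      have "(F st v* ?P (k # ks)) $ j < ((?c *\<^sub>R F k) v* ?P ks) $ j" for j
        unfolding split using loss[of k] True by (intro row_mult_strict_mono pos_P) simp
      then have "(F st v* ?P (k # ks)) $ j < ?T (k # ks) * F (final k ks) $ j" for j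
        unfolding scale using IH_le less_le_trans by blast
      then show ?thesis using True by simp
    next
      case False
      then have st: "st = (\<not> k)" by simp
      have "F st v* wprod A' B' (tok k) = ?c *\<^sub>R F k"
        using step[of k] unfolding st by (simp add: vec_eq_iff)
      then have L: "(F st v* ?P (k # ks)) $ j = ?c * (F k v* ?P ks) $ j" for j
        unfolding split by (simp only: scale)
      have alt: "alternates st (k # ks) \<longleftrightarrow> alternates k ks" and fin: "final st (k # ks) = final k ks"
        using False by auto
      show ?thesis
        unfolding alt fin L T using Cons.IH[of k] c by (simp add: mult.assoc)
    qed
  qed
  show ?thesis
    using trace_eq_of_row_eq[OF F[of st] T_pos[of ts], of "?P ts"]
      trace_less_of_row_less[OF F[of st] pos_P[of ts] T_pos[of ts]]
      growth[of st ts] assms det_wprod[OF det] by (simp add: wt_eq split: if_splits)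
qed

lemma wt_abb: "wt (wpow [La, Lb, Lb] n) = (\<tau> ^ 3) ^ n + 1 / (\<tau> ^ 3) ^ n"
proof -
  \<comment> \<open>The alternating list ab, b, ab, b, and so on, started in state
    \<open>False\<close>, closes up and attains equality.\<close>
  define ts where "ts n = concat (replicate n [True, False])" for n
  have ts: "concat (map tok (ts n)) = wpow [La, Lb, Lb] n"
    and "alternates False (ts n)" "final False (ts n) = False" for n
    by (induction n) (simp_all add: ts_def wpow_Suc)
  then have "wt (wpow [La, Lb, Lb] n) =
    \<tau> ^ length (wpow [La, Lb, Lb] n) + 1 / \<tau> ^ length (wpow [La, Lb, Lb] n)"
    using wt_tokens[of False "ts n"] unfolding ts by simp
  moreover have "length (wpow [La, Lb, Lb] n) = 3 * n" by simp
  ultimately show ?thesis by (simp only: power_mult)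
qed

lemma wt_tokens_le:
  assumes "ts \<noteq> []" and len: "length (concat (map tok ts)) = 3 * n"
  shows "wt (concat (map tok ts)) \<le> (\<tau> ^ 3) ^ n + 1 / (\<tau> ^ 3) ^ n"
    and "wt (concat (map tok ts)) = (\<tau> ^ 3) ^ n + 1 / (\<tau> ^ 3) ^ n \<Longrightarrow>
      \<exists>j. concat (map tok ts) = wpow (rotate j [La, Lb, Lb]) n"
proof -
  \<comment> \<open>Starting at the last token also compares it with the first, as the cyclic trace
    requires.\<close>
  let ?st = "last ts"
  have st: "final ?st ts = ?st" using assms(1) by (rule final_last)
  note wt = wt_tokens[OF st, unfolded len power_mult]
  show "wt (concat (map tok ts)) \<le> (\<tau> ^ 3) ^ n + 1 / (\<tau> ^ 3) ^ n"
    using wt by (simp split: if_splits)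
  assume "wt (concat (map tok ts)) = (\<tau> ^ 3) ^ n + 1 / (\<tau> ^ 3) ^ n"
  then have "alternates ?st ts" using wt by (simp split: if_splits)
  then obtain n' where n': "concat (map tok ts) = wpow (tok (\<not> ?st) @ tok ?st) n'"
    using alternates_cyclic st by blast
  have "length (tok (\<not> ?st) @ tok ?st) = 3" by (cases ?st) simp_all
  then have "n' = n" using arg_cong[OF n', of length] len by simp
  then show "\<exists>j. concat (map tok ts) = wpow (rotate j [La, Lb, Lb]) n"
    using n' wpow_tokens_eq_rotate[of ?st n] by simp
qed

text \<open>Induction on the number of a's: a rotation ending in b either factors into tokens or
  contains aab, and replacing aab by abb removes one a and strictly raises the trace.\<close>

lemma wt_le:
  assumes "0 < n" "length v = 3 * n"
  shows "wt v \<le> (\<tau> ^ 3) ^ n + 1 / (\<tau> ^ 3) ^ n \<and>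
    (wt v = (\<tau> ^ 3) ^ n + 1 / (\<tau> ^ 3) ^ n \<longrightarrow> (\<exists>j. v = wpow (rotate j [La, Lb, Lb]) n))"
  using assms(2)
proof (induction "count_list v La" arbitrary: v rule: less_induct)
  case less
  show ?case
  proof (cases "Lb \<in> set v")
    case False
    then have "\<forall>x\<in>set v. x = La" by (metis letter.exhaust)
    then have "v = replicate (3 * n) La" using less.prems by (simp add: replicate_eqI)
    then show ?thesis using wt_replicate_a_less[OF assms(1)] by simp
  next
    case True
    then obtain p q where v: "v = (p @ [Lb]) @ q"
      by (metis split_list append.assoc append_Cons append_Nil)
    define u where "u = q @ p @ [Lb]"
    have wt_u: "wt v = wt u" unfolding v u_def using trace_wprod_commute by blast
    have v_rot: "v = rotate (length q) u" unfolding v u_def by (simp add: rotate_append)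
    have len_u: "length u = 3 * n" using less.prems by (simp add: v u_def)
    have "(\<exists>ts. u = concat (map tok ts)) \<or> (\<exists>p q. u = p @ [La, La, Lb] @ q)"
      by (rule tokenize_or_aab) (simp add: u_def)
    then show ?thesis
    proof (elim disjE exE)
      fix ts assume ts: "u = concat (map tok ts)"
      then have "ts \<noteq> []" using len_u assms(1) by auto
      note le = wt_tokens_le[OF this len_u[unfolded ts], folded ts]
      show ?thesis
      proof (intro conjI impI)
        show "wt v \<le> (\<tau> ^ 3) ^ n + 1 / (\<tau> ^ 3) ^ n" using le(1) wt_u by simp
        assume "wt v = (\<tau> ^ 3) ^ n + 1 / (\<tau> ^ 3) ^ n"
        then obtain j where "u = wpow (rotate j [La, Lb, Lb]) n" using le(2) wt_u by auto
        then have "v = wpow (rotate (length q + j) [La, Lb, Lb]) n"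
          by (simp add: v_rot rotate_wpow rotate_rotate)
        then show "\<exists>j. v = wpow (rotate j [La, Lb, Lb]) n" by blast
      qed
    next
      fix p' q' assume u: "u = p' @ [La, La, Lb] @ q'"
      let ?u' = "p' @ [La, Lb, Lb] @ q'"
      have "count_list ?u' La < count_list u La" "length ?u' = 3 * n"
        using len_u by (simp_all add: u)
      moreover have "count_list u La = count_list v La"
        by (simp add: v_rot count_list_rotate)
      ultimately have "wt ?u' \<le> (\<tau> ^ 3) ^ n + 1 / (\<tau> ^ 3) ^ n"
        using less.hyps by metis
      \<comment> \<open>The strict increase rules out equality for \<open>v\<close>, so nothing has
        to be traced back through the replacement.\<close>
      then have "wt v < (\<tau> ^ 3) ^ n + 1 / (\<tau> ^ 3) ^ n"
        using wt_aab_less[of p' q'] wt_u u by simp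
      then show ?thesis by simp
    qed
  qed
qed

end

section \<open>Numerical data of the integer matrices\<close>

lemma exists_trace_data:
  assumes A: "A \<in> SL2_nonneg" and B: "B \<in> SL2_nonneg" and less: "trace A < trace B"
    and AB: "trace (A ** B) = trace (B ** B)"
  shows "\<exists>s t \<mu> m \<tau>. trace_data (real_mat A) (real_mat B) s t \<mu> m \<tau>"
proof -
  \<comment> \<open>The diagonal entries are nonnegative integers with product at least 1.\<close>
  have A_ge: "trace A \<ge> 2"
  proof -
    have "A$1$1 * A$2$2 = 1 + A$1$2 * A$2$1" "0 \<le> A$1$2 * A$2$1" and nn: "0 \<le> A$1$1" "0 \<le> A$2$2"
      using A by (simp_all add: SL2_nonneg_def det_2)
    then have "A$1$1 * A$2$2 \<noteq> 0" by linarith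
    then have "A$1$1 \<noteq> 0" "A$2$2 \<noteq> 0" by simp_all
    then show ?thesis using nn by (simp add: trace_2)
  qed
  define s t where "s = real_of_int (trace A)" and "t = real_of_int (trace B)"
  have s: "2 \<le> s" "s + 1 \<le> t" using A_ge less by (simp_all add: s_def t_def)
  obtain \<mu> where \<mu>: "1 \<le> \<mu>" "\<mu> + 1 / \<mu> = t"
    using exists_add_inverse[of t] s by force
  \<comment> \<open>The aim is that t^3 - 2t - s = t tr(AB) - s, the trace of AB^2, exceeds 2, so
    that its leading eigenvalue \<open>a\<close> exceeds 1.\<close>
  have "t * 7 \<le> t * (t\<^sup>2 - 2)"
  proof -
    have "3\<^sup>2 \<le> t\<^sup>2" using s by (intro power_mono) auto
    then show ?thesis using s by (intro mult_left_mono) auto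
  qed
  also have "t * (t\<^sup>2 - 2) = t ^ 3 - 2 * t" by algebra
  finally have u: "2 < t ^ 3 - 2 * t - s" using s by linarith
  then obtain a where a: "1 \<le> a" "a + 1 / a = t ^ 3 - 2 * t - s"
    using exists_add_inverse[of "t ^ 3 - 2 * t - s"] by force
  have "a \<noteq> 1" using a u by auto
  then have a_gt: "1 < a" using a by simp
  have trace_BB: "trace (B ** B) = (trace B)\<^sup>2 - 2"
  proof -
    have "B$1$1 * B$2$2 = 1 + B$1$2 * B$2$1"
      using B by (simp add: SL2_nonneg_def det_2)
    then show ?thesis by (simp add: trace_2 mult2_nth power2_eq_square algebra_simps)
  qed
  have "trace_data (real_mat A) (real_mat B) s t \<mu> (1 / \<mu>) (root 3 a)"
  proof
    show "det (real_mat A) = 1" "det (real_mat B) = 1"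
      using A B by (simp_all add: det_real_mat SL2_nonneg_def)
    show "trace (real_mat A ** real_mat B) = t\<^sup>2 - 2"
      by (simp add: AB trace_BB t_def trace_real_mat flip: real_mat_mult)
    show "1 < \<mu>" using \<mu> s by (cases "\<mu> = 1") auto
    show "1 < root 3 a" using a_gt by simp
    show "root 3 a ^ 3 + 1 / root 3 a ^ 3 = t ^ 3 - 2 * t - s" using a by simp
  qed (use \<mu> s in \<open>simp_all add: s_def t_def trace_real_mat\<close>)
  then show ?thesis by blast
qed

section \<open>Lyndon words among powers of rotations of abb\<close>

lemma not_lyndon:
  assumes "\<not> lex_less w (rotate k w)" "0 < k" "k < length w"
  shows "\<not> lyndon w"
  using assms by (auto simp: lyndon_def)

text \<open>For \<open>n\<close> above 1 the rotation by 3 is proper and fixes \<open>w\<close>,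
  which a Lyndon word forbids. Three rotations remain for \<open>n = 1\<close>.\<close>

lemma lyndon_wpow_rotate_abb:
  assumes "lyndon w" and w: "w = wpow (rotate k [La, Lb, Lb]) n"
  shows "w = [La, Lb, Lb]"
proof -
  have "n \<noteq> 0" using assms unfolding lyndon_def by (metis wpow_0)
  have "rotate 3 [La, Lb, Lb] = [La, Lb, Lb]" by (simp add: numeral_3_eq_3)
  then have "rotate 3 (rotate k [La, Lb, Lb]) = rotate k [La, Lb, Lb]"
    by (metis rotate_rotate add.commute)
  then have "rotate 3 w = w" unfolding w rotate_wpow by (rule arg_cong)
  moreover have "\<not> lex_less w w"
    unfolding lex_less_def by (rule lexord_irreflexive) simp
  ultimately have "\<not> 3 < length w"
    using not_lyndon[of w 3] assms(1) by auto
  then have "n = 1" using w \<open>n \<noteq> 0\<close> by simp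
  then have "w = rotate (k mod 3) [La, Lb, Lb]"
    using w rotate_conv_mod[of k "[La, Lb, Lb]"] by (simp add: wpow_def)
  moreover have "k mod 3 < 3" by simp
  then have "k mod 3 = 0 \<or> k mod 3 = 1 \<or> k mod 3 = 2" by linarith
  ultimately have "w = [La, Lb, Lb] \<or> w = [Lb, Lb, La] \<or> w = [Lb, La, Lb]"
    by (elim disjE) (simp_all add: numeral_2_eq_2)
  moreover have "\<not> lyndon [Lb, Lb, La]"
    by (rule not_lyndon[of _ 2]) (simp_all add: lex_less_def numeral_2_eq_2)
  moreover have "\<not> lyndon [Lb, La, Lb]"
    by (rule not_lyndon[of _ 1]) (simp_all add: lex_less_def)
  ultimately show ?thesis using assms(1) by blast
qed

lemma lyndon_abb: "lyndon [La, Lb, Lb]"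
  unfolding lyndon_def
proof (intro conjI allI impI)
  fix k assume "0 < k \<and> k < length [La, Lb, Lb]"
  then have "k = 1 \<or> k = 2" by auto
  then show "lex_less [La, Lb, Lb] (rotate k [La, Lb, Lb])"
    by (elim disjE) (simp_all add: lex_less_def numeral_2_eq_2)
qed simp

theorem theorem6p7:
  fixes A B :: imat
  assumes "A \<in> SL2_nonneg" and "B \<in> SL2_nonneg"
    and "A ** B \<noteq> B ** A"
    and "well_oriented A B"
    and "trace A < trace B"
    and "trace (A ** B) = trace (B ** B)"
  shows "\<forall>S. complete_optimal_set A B S \<longleftrightarrow> S = {[La, Lb, Lb]}"
proof -
  obtain s t \<mu> m \<tau> where "trace_data (real_mat A) (real_mat B) s t \<mu> m \<tau>"
    using exists_trace_data assms(1,2,5,6) by blast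
  then interpret trace_data "real_mat A" "real_mat B" s t \<mu> m \<tau> .
  \<comment> \<open>The powers compared by \<open>wle\<close> both have length
    \<open>3 * length u\<close>, which is the setting of \<open>wt_le\<close>.\<close>
  have wle_abb: "wle A B u [La, Lb, Lb]" if "u \<noteq> []" for u
  proof -
    have "wt (wpow u 3) \<le> wt (wpow [La, Lb, Lb] (length u))"
      using wt_le[of "length u" "wpow u 3"] wt_abb[of "length u"] that by simp
    then show ?thesis
      by (simp add: wle_def numeral_3_eq_3 flip: wtr_eq_trace_wprod)
  qed
  then have max_abb: "maximal_word A B [La, Lb, Lb]"
    by (simp add: maximal_word_def)
  have max_imp: "\<exists>k n. n \<ge> 1 \<and> w = wpow (rotate k [La, Lb, Lb]) n" if "maximal_word A B w" for w
  proof -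
    have "w \<noteq> []" "wle A B [La, Lb, Lb] w" using that by (auto simp: maximal_word_def)
    then have "wt (wpow [La, Lb, Lb] (length w)) \<le> wt (wpow w 3)"
      by (simp add: wle_def numeral_3_eq_3 flip: wtr_eq_trace_wprod)
    then obtain j where "wpow w 3 = wpow (rotate j [La, Lb, Lb]) (length w)"
      using wt_le[of "length w" "wpow w 3"] wt_abb[of "length w"] \<open>w \<noteq> []\<close> by force
    then obtain n where "w = wpow (rotate j [La, Lb, Lb]) n"
      using wpow3_eq_rotate_abb by blast
    moreover from this have "n \<ge> 1" using \<open>w \<noteq> []\<close> by (cases n) auto
    ultimately show ?thesis by blast
  qed
  show ?thesis
  proof (intro allI iffI)
    fix S assume S: "complete_optimal_set A B S"
    \<comment> \<open>Every member of \<open>S\<close> is a maximal Lyndon word, hence a power of a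
      rotation of abb, hence abb itself.\<close>
    have "w = [La, Lb, Lb]" if "w \<in> S" for w
      using S that max_imp lyndon_wpow_rotate_abb unfolding complete_optimal_set_def by metis
    moreover have "S \<noteq> {}"
      using S max_abb unfolding complete_optimal_set_def by blast
    ultimately show "S = {[La, Lb, Lb]}" by blast
  next
    fix S assume "S = {[La, Lb, Lb]}"
    then show "complete_optimal_set A B S"
      using max_abb lyndon_abb max_imp by (simp add: complete_optimal_set_def)
  qed
qed

end
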